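(* Let $\lambda_1,\lambda_2,\lambda_3\in\mathbb{R}$ and let $\mathrm{Im}(\mathbb{K})=T_{S_{\mathbb{K}}}(e)$ be the Lie algebra of the Lie group $S_{\mathbb{K}}$ of unit 3-parameter generalized quaternions. Let $K=[\mathcal{K}(e_i,e_j)]_{1\le i,j\le3}$ be the matrix in the basis $\{e_1,e_2,e_3\}$ of the Killing form $\mathcal{K}(X,Y)=\mathrm{tr}(Ad_XAd_Y)$, where $Ad_X(Y)=[X,Y]$, and let $$\varepsilon=\begin{bmatrix}\lambda_1\lambda_2&0&0\\0&\lambda_1\lambda_3&0\\0&0&\lambda_2\lambda_3\end{bmatrix}.$$ Then $K=-8\varepsilon$.
   Context: Given $\lambda_1,\lambda_2,\lambda_3\in\mathbb{R}$, $\mathbb{K}$ is the (associative, unital) real algebra with vector-space basis $1,e_1,e_2,e_3$, unit $1$, and bilinear multiplication determined by $e_1^2=-\lambda_1\lambda_2$, $e_2^2=-\lambda_1\lambda_3$, $e_3^2=-\lambda_2\lambda_3$, $e_1e_2=\lambda_1e_3=-e_2e_1$, $e_2e_3=\lambda_3e_1=-e_3e_2$, $e_3e_1=\lambda_2e_2=-e_1e_3$. $S_{\mathbb{K}}=\{a_0+a_1e_1+a_2e_2+a_3e_3:a_0^2+\lambda_1\lambda_2a_1^2+\lambda_1\lambda_3a_2^2+\lambda_2\lambda_3a_3^2=1\}$ is a Lie group under this multiplication with Lie algebra $T_{S_{\mathbb{K}}}(e)=\mathrm{Im}(\mathbb{K})=\mathrm{span}\{e_1,e_2,e_3\}$, whose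 Lie bracket is the bilinear antisymmetric map with $[e_1,e_2]=2\lambda_1e_3$, $[e_2,e_3]=2\lambda_3e_1$, $[e_3,e_1]=2\lambda_2e_2$. *)

theory Defs
  imports "HOL-Analysis.Analysis"
begin

text \<open>
  The algebra depends on three real parameters, so its multiplication cannot be an instance of
  the class of real algebras. Its vector space is \<open>real \<times> (real ^ 3)\<close>: the pair \<open>(a\<^sub>0, a)\<close> is
  \<open>a\<^sub>0 + a\<^sub>1 e\<^sub>1 + a\<^sub>2 e\<^sub>2 + a\<^sub>3 e\<^sub>3\<close>, and all products below carry the parameters explicitly.
\<close>

type_synonym gquat = "real \<times> (real ^ 3)"

definition gq_one :: gquat where
  "gq_one = (1, 0)"

definition gq_e :: "3 \<Rightarrow> gquat" where
  "gq_e i = (0, axis i 1)"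

definition gq_mult :: "real \<Rightarrow> real \<Rightarrow> real \<Rightarrow> gquat \<Rightarrow> gquat \<Rightarrow> gquat" where
  "gq_mult l1 l2 l3 x y =
    (let a0 = fst x; a = snd x; b0 = fst y; b = snd y in
      (a0 * b0 - l1 * l2 * a$1 * b$1 - l1 * l3 * a$2 * b$2 - l2 * l3 * a$3 * b$3,
       vector [a0 * b$1 + a$1 * b0 + l3 * (a$2 * b$3 - a$3 * b$2),
               a0 * b$2 + a$2 * b0 + l2 * (a$3 * b$1 - a$1 * b$3),
               a0 * b$3 + a$3 * b0 + l1 * (a$1 * b$2 - a$2 * b$1)]))"

lemma gq_eq_iff:
  fixes x y :: gquat
  shows "x = y \<longleftrightarrow> fst x = fst y \<and> snd x $ 1 = snd y $ 1 \<and> snd x $ 2 = snd y $ 2 \<and> snd x $ 3 = snd y $ 3"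
  by (auto simp: prod_eq_iff vec_eq_iff forall_3)

lemma fst_gq_mult:
  "fst (gq_mult l1 l2 l3 x y) =
    fst x * fst y - l1 * l2 * snd x $ 1 * snd y $ 1 - l1 * l3 * snd x $ 2 * snd y $ 2
      - l2 * l3 * snd x $ 3 * snd y $ 3"
  by (simp add: gq_mult_def Let_def)

lemma snd_gq_mult:
  "snd (gq_mult l1 l2 l3 x y) $ 1 =
    fst x * snd y $ 1 + snd x $ 1 * fst y + l3 * (snd x $ 2 * snd y $ 3 - snd x $ 3 * snd y $ 2)"
  "snd (gq_mult l1 l2 l3 x y) $ 2 =
    fst x * snd y $ 2 + snd x $ 2 * fst y + l2 * (snd x $ 3 * snd y $ 1 - snd x $ 1 * snd y $ 3)"
  "snd (gq_mult l1 l2 l3 x y) $ 3 =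
    fst x * snd y $ 3 + snd x $ 3 * fst y + l1 * (snd x $ 1 * snd y $ 2 - snd x $ 2 * snd y $ 1)"
  by (simp_all add: gq_mult_def Let_def)

lemma gq_one_sel:
  "fst gq_one = 1" "snd gq_one = 0"
  by (simp_all add: gq_one_def)

lemma gq_e_sel:
  "fst (gq_e i) = 0" "snd (gq_e i) $ j = (if j = i then 1 else 0)"
  by (simp_all add: gq_e_def axis_def)

lemmas gq_simps = gq_eq_iff fst_gq_mult snd_gq_mult gq_one_sel gq_e_sel

lemma gq_mult_table:
  "gq_mult l1 l2 l3 (gq_e 1) (gq_e 1) = - (l1 * l2) *\<^sub>R gq_one"
  "gq_mult l1 l2 l3 (gq_e 2) (gq_e 2) = - (l1 * l3) *\<^sub>R gq_one"
  "gq_mult l1 l2 l3 (gq_e 3) (gq_e 3) = - (l2 * l3) *\<^sub>R gq_one"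
  "gq_mult l1 l2 l3 (gq_e 1) (gq_e 2) = l1 *\<^sub>R gq_e 3"
  "gq_mult l1 l2 l3 (gq_e 2) (gq_e 1) = - l1 *\<^sub>R gq_e 3"
  "gq_mult l1 l2 l3 (gq_e 2) (gq_e 3) = l3 *\<^sub>R gq_e 1"
  "gq_mult l1 l2 l3 (gq_e 3) (gq_e 2) = - l3 *\<^sub>R gq_e 1"
  "gq_mult l1 l2 l3 (gq_e 3) (gq_e 1) = l2 *\<^sub>R gq_e 2"
  "gq_mult l1 l2 l3 (gq_e 1) (gq_e 3) = - l2 *\<^sub>R gq_e 2"
  by (simp_all add: gq_simps)

lemma gq_mult_one:
  "gq_mult l1 l2 l3 gq_one x = x" "gq_mult l1 l2 l3 x gq_one = x"
  by (simp_all add: gq_simps)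

lemma gq_mult_assoc:
  "gq_mult l1 l2 l3 (gq_mult l1 l2 l3 x y) z = gq_mult l1 l2 l3 x (gq_mult l1 l2 l3 y z)"
  by (simp add: gq_simps algebra_simps)

lemma bilinear_gq_mult: "bilinear (gq_mult l1 l2 l3)"
  by (auto simp: bilinear_def linear_iff gq_simps algebra_simps)

definition gq_norm_form :: "real \<Rightarrow> real \<Rightarrow> real \<Rightarrow> gquat \<Rightarrow> real" where
  "gq_norm_form l1 l2 l3 x =
    (fst x)\<^sup>2 + l1 * l2 * (snd x $ 1)\<^sup>2 + l1 * l3 * (snd x $ 2)\<^sup>2 + l2 * l3 * (snd x $ 3)\<^sup>2"

definition gq_sphere :: "real \<Rightarrow> real \<Rightarrow> real \<Rightarrow> gquat set" where
  "gq_sphere l1 l2 l3 = {x. gq_norm_form l1 l2 l3 x = 1}"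

definition gq_conj :: "gquat \<Rightarrow> gquat" where
  "gq_conj x = (fst x, - snd x)"

lemma gq_norm_form_mult:
  "gq_norm_form l1 l2 l3 (gq_mult l1 l2 l3 x y) = gq_norm_form l1 l2 l3 x * gq_norm_form l1 l2 l3 y"
  by (simp add: gq_norm_form_def gq_simps power2_eq_square algebra_simps)

lemma gq_sphere_group:
  "gq_one \<in> gq_sphere l1 l2 l3"
  "x \<in> gq_sphere l1 l2 l3 \<Longrightarrow> y \<in> gq_sphere l1 l2 l3 \<Longrightarrow> gq_mult l1 l2 l3 x y \<in> gq_sphere l1 l2 l3"
  "x \<in> gq_sphere l1 l2 l3 \<Longrightarrow> gq_conj x \<in> gq_sphere l1 l2 l3"
  "x \<in> gq_sphere l1 l2 l3 \<Longrightarrow> gq_mult l1 l2 l3 x (gq_conj x) = gq_one"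
  "x \<in> gq_sphere l1 l2 l3 \<Longrightarrow> gq_mult l1 l2 l3 (gq_conj x) x = gq_one"
proof -
  show "x \<in> gq_sphere l1 l2 l3 \<Longrightarrow> y \<in> gq_sphere l1 l2 l3 \<Longrightarrow> gq_mult l1 l2 l3 x y \<in> gq_sphere l1 l2 l3"
    by (simp add: gq_sphere_def gq_norm_form_mult)
qed (simp_all add: gq_sphere_def gq_norm_form_def gq_conj_def gq_simps power2_eq_square algebra_simps)

text \<open>
  Velocities of curves in \<open>S\<close> through \<open>p\<close>. For a regular level set such as the one below, curves
  differentiable at \<open>0\<close> and smooth curves give the same vectors.
\<close>

definition tangent_space :: "'a::real_normed_vector set \<Rightarrow> 'a \<Rightarrow> 'a set" where
  "tangent_space S p =
    {v. \<exists>\<gamma>. \<gamma> 0 = p \<and> (\<forall>\<^sub>F t in nhds 0. \<gamma> t \<in> S) \<and> (\<gamma> has_vector_derivative v) (at (0::real))}"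

definition gq_lie_algebra :: "real \<Rightarrow> real \<Rightarrow> real \<Rightarrow> gquat set" where
  "gq_lie_algebra l1 l2 l3 = tangent_space (gq_sphere l1 l2 l3) gq_one"

text \<open>
  On imaginary elements the bracket is given by the structure constants of the basis
  \<open>e\<^sub>1, e\<^sub>2, e\<^sub>3\<close>. Being a function on the whole algebra, it ignores the (central) real parts.
\<close>

definition gq_bracket :: "real \<Rightarrow> real \<Rightarrow> real \<Rightarrow> gquat \<Rightarrow> gquat \<Rightarrow> gquat" where
  "gq_bracket l1 l2 l3 x y =
    (let a = snd x; b = snd y in
      (2 * l3 * (a$2 * b$3 - a$3 * b$2)) *\<^sub>R gq_e 1
      + (2 * l2 * (a$3 * b$1 - a$1 * b$3)) *\<^sub>R gq_e 2
      + (2 * l1 * (a$1 * b$2 - a$2 * b$1)) *\<^sub>R gq_e 3)"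

lemma gq_bracket_table:
  "gq_bracket l1 l2 l3 (gq_e 1) (gq_e 2) = (2 * l1) *\<^sub>R gq_e 3"
  "gq_bracket l1 l2 l3 (gq_e 2) (gq_e 3) = (2 * l3) *\<^sub>R gq_e 1"
  "gq_bracket l1 l2 l3 (gq_e 3) (gq_e 1) = (2 * l2) *\<^sub>R gq_e 2"
  by (simp_all add: gq_bracket_def Let_def gq_simps)

lemma gq_bracket_antisym: "gq_bracket l1 l2 l3 x y = - gq_bracket l1 l2 l3 y x"
  by (simp add: gq_bracket_def Let_def gq_simps algebra_simps)

lemma bilinear_gq_bracket: "bilinear (gq_bracket l1 l2 l3)"
  by (auto simp: bilinear_def linear_iff gq_bracket_def Let_def gq_simps algebra_simps)

lemma gq_bracket_commutator:
  "gq_bracket l1 l2 l3 x y = gq_mult l1 l2 l3 x y - gq_mult l1 l2 l3 y x"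
  by (simp add: gq_bracket_def Let_def gq_simps algebra_simps)

lemma gq_lie_algebra_eq: "gq_lie_algebra l1 l2 l3 = span (range gq_e)"
proof -
  have "gq_lie_algebra l1 l2 l3 = {v. fst v = 0}"
  proof (intro set_eqI iffI)
    fix v assume "v \<in> gq_lie_algebra l1 l2 l3"
    then obtain \<gamma> where \<gamma>: "\<gamma> 0 = gq_one" "\<forall>\<^sub>F t in nhds 0. \<gamma> t \<in> gq_sphere l1 l2 l3"
      "(\<gamma> has_vector_derivative v) (at 0)"
      by (auto simp: gq_lie_algebra_def tangent_space_def)
    have f: "((\<lambda>t. fst (\<gamma> t)) has_real_derivative fst v) (at 0)"
      using bounded_linear.has_vector_derivative[OF bounded_linear_fst \<gamma>(3)]
      by (simp add: has_real_derivative_iff_has_vector_derivative)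
    have s: "((\<lambda>t. snd (\<gamma> t) $ i) has_real_derivative snd v $ i) (at 0)" for i
      using bounded_linear.has_vector_derivative[OF bounded_linear_compose[OF bounded_linear_vec_nth bounded_linear_snd] \<gamma>(3)]
      by (simp add: has_real_derivative_iff_has_vector_derivative)
    have "((\<lambda>t. gq_norm_form l1 l2 l3 (\<gamma> t)) has_real_derivative 2 * fst v) (at 0)"
      unfolding gq_norm_form_def
      by (rule derivative_eq_intros f s refl)+ (simp add: \<gamma>(1) gq_one_sel)
    moreover have "\<forall>\<^sub>F t in nhds 0. gq_norm_form l1 l2 l3 (\<gamma> t) = 1"
      using \<gamma>(2) by (simp add: gq_sphere_def)
    ultimately have "((\<lambda>t. 1) has_real_derivative 2 * fst v) (at (0::real))"
      using DERIV_cong_ev[of 0 0 "\<lambda>t. gq_norm_form l1 l2 l3 (\<gamma> t)" "\<lambda>t. 1"] by blast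
    then have "2 * fst v = 0"
      by (rule DERIV_unique) simp
    then show "v \<in> {v. fst v = 0}" by simp
  next
    fix v :: gquat assume v: "v \<in> {v. fst v = 0}"
    define q where "q = gq_norm_form l1 l2 l3 v"
    define \<gamma> where "\<gamma> t = (sqrt (1 - q * t\<^sup>2), t *\<^sub>R snd v)" for t :: real
    have "\<gamma> 0 = gq_one" by (simp add: \<gamma>_def gq_one_def)
    moreover have "\<forall>\<^sub>F t in nhds 0. \<gamma> t \<in> gq_sphere l1 l2 l3"
    proof -
      have "((\<lambda>t. 1 - q * t\<^sup>2) \<longlongrightarrow> 1 - q * 0\<^sup>2) (nhds (0::real))"
        by (intro tendsto_intros filterlim_ident)
      then have "\<forall>\<^sub>F t in nhds 0. 1 - q * t\<^sup>2 > 0"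
        by (rule order_tendstoD) simp
      then show ?thesis
      proof (rule eventually_mono)
        fix t :: real assume "1 - q * t\<^sup>2 > 0"
        then show "\<gamma> t \<in> gq_sphere l1 l2 l3"
          using v by (simp add: \<gamma>_def gq_sphere_def gq_norm_form_def q_def power_mult_distrib algebra_simps)
      qed
    qed
    moreover have "(\<gamma> has_vector_derivative v) (at 0)"
    proof -
      have "((\<lambda>t. sqrt (1 - q * t\<^sup>2)) has_real_derivative 0) (at 0)"
        by (rule derivative_eq_intros refl | simp)+
      then have "((\<lambda>t. sqrt (1 - q * t\<^sup>2)) has_vector_derivative 0) (at 0)"
        by (simp add: has_real_derivative_iff_has_vector_derivative)
      moreover have "((\<lambda>t. t *\<^sub>R snd v) has_vector_derivative snd v) (at 0)"
        by (auto intro!: derivative_eq_intros)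
      ultimately have "(\<gamma> has_vector_derivative (0, snd v)) (at 0)"
        unfolding \<gamma>_def[abs_def] by (rule has_vector_derivative_Pair)
      moreover have "(0, snd v) = v" using v by (simp add: prod_eq_iff)
      ultimately show ?thesis by simp
    qed
    ultimately show "v \<in> gq_lie_algebra l1 l2 l3"
      unfolding gq_lie_algebra_def tangent_space_def by blast
  qed
  also have "\<dots> = span (range gq_e)"
  proof
    show "{v. fst v = 0} \<subseteq> span (range gq_e)"
    proof
      fix v :: gquat assume "v \<in> {v. fst v = 0}"
      then have "v = (snd v $ 1) *\<^sub>R gq_e 1 + (snd v $ 2) *\<^sub>R gq_e 2 + (snd v $ 3) *\<^sub>R gq_e 3"
        by (simp add: gq_simps)
      then show "v \<in> span (range gq_e)"
        by (metis rangeI span_add span_base span_scale)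
    qed
    show "span (range gq_e) \<subseteq> {v. fst v = 0}"
      by (rule span_minimal) (auto simp: gq_e_sel subspace_def)
  qed
  finally show ?thesis .
qed

text \<open>
  The bracket is the one of the Lie group: the derivative at the unit of the conjugation action
  on the Lie algebra (the inverse of a unit element is its conjugate).
\<close>

lemma gq_bracket_deriv_conjugation:
  assumes "\<gamma> 0 = gq_one" and g: "(\<gamma> has_vector_derivative x) (at 0)"
    and "x \<in> gq_lie_algebra l1 l2 l3" "y \<in> gq_lie_algebra l1 l2 l3"
  shows "((\<lambda>t. gq_mult l1 l2 l3 (gq_mult l1 l2 l3 (\<gamma> t) y) (gq_conj (\<gamma> t)))
            has_vector_derivative gq_bracket l1 l2 l3 x y) (at 0)"
proof -
  interpret B: bounded_bilinear "gq_mult l1 l2 l3"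
    using bilinear_gq_mult by (simp add: bilinear_conv_bounded_bilinear)
  have "bounded_linear gq_conj"
    unfolding gq_conj_def
    by (intro bounded_linear_Pair bounded_linear_fst bounded_linear_minus bounded_linear_snd)
  then have c: "((\<lambda>t. gq_conj (\<gamma> t)) has_vector_derivative gq_conj x) (at 0)"
    by (rule bounded_linear.has_vector_derivative[OF _ g])
  have "((\<lambda>t. gq_mult l1 l2 l3 (\<gamma> t) y) has_vector_derivative gq_mult l1 l2 l3 x y) (at 0)"
    by (rule bounded_linear.has_vector_derivative[OF B.bounded_linear_left g])
  note B.has_vector_derivative[OF this c]
  moreover have "x \<in> {v. fst v = 0}"
  proof -
    have "span (range gq_e) \<subseteq> {v. fst v = 0}"
      by (rule span_minimal) (auto simp: gq_e_sel subspace_def)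
    then show ?thesis using assms(3) by (auto simp: gq_lie_algebra_eq)
  qed
  then have "gq_conj x = - x" by (simp add: gq_conj_def prod_eq_iff)
  moreover have "gq_conj gq_one = gq_one" by (simp add: gq_conj_def gq_one_def)
  ultimately show ?thesis
    by (simp add: assms(1) gq_mult_one gq_bracket_commutator B.minus_right)
qed

definition gq_Ad :: "real \<Rightarrow> real \<Rightarrow> real \<Rightarrow> gquat \<Rightarrow> gquat \<Rightarrow> gquat" where
  "gq_Ad l1 l2 l3 x = (\<lambda>y. gq_bracket l1 l2 l3 x y)"

text \<open>
  The library has the trace of a square matrix only. The trace of an endomorphism \<open>f\<close> of a
  finite-dimensional subspace \<open>V\<close> is the sum of the diagonal coefficients of \<open>f\<close> in some basis of
  \<open>V\<close>; the lemma below shows that the choice of the basis does not matter.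
\<close>

definition endo_trace :: "'a::euclidean_space set \<Rightarrow> ('a \<Rightarrow> 'a) \<Rightarrow> real" where
  "endo_trace V f =
    (let B = (SOME B. independent B \<and> span B = V) in \<Sum>b\<in>B. representation B (f b) b)"

lemma endo_trace_eq:
  assumes f: "linear f" and V: "f ` V \<subseteq> V" and C: "independent C" "span C = V"
  shows "endo_trace V f = (\<Sum>c\<in>C. representation C (f c) c)"
proof -
  define B where "B = (SOME B. independent B \<and> span B = V)"
  have B: "independent B" "span B = V"
    using someI_ex[of "\<lambda>B. independent B \<and> span B = V"] C unfolding B_def by blast+
  have fin: "finite B" "finite C"
    using B C independent_bound by blast+
  have bV: "b \<in> V" if "b \<in> B" for b using that B span_base by blast
  have cV: "c \<in> V" if "c \<in> C" for c using that C span_base by blast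
  have exp: "v = (\<Sum>c\<in>C. representation C v c *\<^sub>R c)" if "v \<in> V" for v
    using sum_representation_eq[OF C(1) _ fin(2) subset_refl] that C by metis
  have exp': "v = (\<Sum>c\<in>B. representation B v c *\<^sub>R c)" if "v \<in> V" for v
    using sum_representation_eq[OF B(1) _ fin(1) subset_refl] that B by metis
  have sc: "r *\<^sub>R v \<in> V" if "v \<in> V" for r v using that C subspace_span subspace_scale by blast
  have fV: "f v \<in> V" if "v \<in> V" for v using that V by blast
  have "representation B (f b) b = (\<Sum>c\<in>C. representation C b c * representation B (f c) b)"
    if "b \<in> B" for b
  proof -
    have "f b = (\<Sum>c\<in>C. representation C b c *\<^sub>R f c)"
      by (subst exp[OF bV[OF that]]) (simp add: linear_sum[OF f] linear_cmul[OF f])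
    also have "representation B \<dots> b = (\<Sum>c\<in>C. representation C b c * representation B (f c) b)"
      using B cV fV sc by (simp add: representation_sum representation_scale)
    finally show ?thesis .
  qed
  then have "endo_trace V f = (\<Sum>b\<in>B. \<Sum>c\<in>C. representation C b c * representation B (f c) b)"
    by (simp add: endo_trace_def B_def[symmetric] Let_def)
  also have "\<dots> = (\<Sum>c\<in>C. \<Sum>b\<in>B. representation C b c * representation B (f c) b)"
    by (rule sum.swap)
  also have "\<dots> = (\<Sum>c\<in>C. representation C (f c) c)"
  proof (rule sum.cong[OF refl])
    fix c assume "c \<in> C"
    then have "f c = (\<Sum>b\<in>B. representation B (f c) b *\<^sub>R b)"
      by (intro exp' fV cV)
    then have "representation C (f c) c = representation C (\<Sum>b\<in>B. representation B (f c) b *\<^sub>R b) c"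
      by simp
    also have "\<dots> = (\<Sum>b\<in>B. representation B (f c) b * representation C b c)"
      using C bV sc by (simp add: representation_sum representation_scale)
    finally show "(\<Sum>b\<in>B. representation C b c * representation B (f c) b) = representation C (f c) c"
      by (simp add: mult.commute)
  qed
  finally show ?thesis .
qed

definition killing_form :: "real \<Rightarrow> real \<Rightarrow> real \<Rightarrow> gquat \<Rightarrow> gquat \<Rightarrow> real" where
  "killing_form l1 l2 l3 x y =
    endo_trace (gq_lie_algebra l1 l2 l3) (gq_Ad l1 l2 l3 x \<circ> gq_Ad l1 l2 l3 y)"

definition killing_matrix :: "real \<Rightarrow> real \<Rightarrow> real \<Rightarrow> real ^ 3 ^ 3" where
  "killing_matrix l1 l2 l3 = (\<chi> i j. killing_form l1 l2 l3 (gq_e i) (gq_e j))"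

definition gq_eps :: "real \<Rightarrow> real \<Rightarrow> real \<Rightarrow> real ^ 3 ^ 3" where
  "gq_eps l1 l2 l3 =
    vector [vector [l1 * l2, 0, 0],
            vector [0, l1 * l3, 0],
            vector [0, 0, l2 * l3]]"

end

theory Submission
  imports Defs
begin

text \<open>
  The coordinate vectors \<open>e\<^sub>1, e\<^sub>2, e\<^sub>3\<close> span the Lie algebra and are orthonormal for the standard
  inner product on \<open>real \<times> (real ^ 3)\<close>. Inner products with them read off coordinates, so the
  trace of an endomorphism \<open>f\<close> becomes \<open>\<Sum>i. f (e\<^sub>i) \<bullet> e\<^sub>i\<close> (\<open>endo_trace_orthonormal\<close>).

  The map \<open>Ad\<close> of \<open>e\<^sub>i\<close> kills \<open>e\<^sub>i\<close> and sends each of the other two basis vectors to a multiple of the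
  other. For \<open>e\<^sub>1\<close> the factors are \<open>2\<lambda>\<^sub>1\<close> (from \<open>e\<^sub>2\<close> to \<open>e\<^sub>3\<close>) and \<open>-2\<lambda>\<^sub>2\<close> (from \<open>e\<^sub>3\<close> to \<open>e\<^sub>2\<close>), so
  the square of this map multiplies both vectors by \<open>-4\<lambda>\<^sub>1\<lambda>\<^sub>2\<close> and its trace is \<open>-8\<lambda>\<^sub>1\<lambda>\<^sub>2\<close>; the other
  two diagonal entries of the Killing matrix arise alike. For \<open>i \<noteq> j\<close> the composite of the maps of
  \<open>e\<^sub>i\<close> and \<open>e\<^sub>j\<close> sends no basis vector to a nonzero multiple of itself, so its trace vanishes.
  All nine entries are instances of one formula for general arguments (\<open>killing_form_eq\<close>).
\<close>

lemma endo_trace_orthonormal: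
  fixes B :: "'a::euclidean_space set"
  assumes f: "linear f" and V: "f ` span B \<subseteq> span B"
    and orth: "pairwise orthogonal B" and unit: "\<And>b. b \<in> B \<Longrightarrow> norm b = 1"
  shows "endo_trace (span B) f = (\<Sum>b\<in>B. f b \<bullet> b)"
proof -
  have "0 \<notin> B" using unit by fastforce
  then have ind: "independent B"
    by (rule pairwise_orthogonal_independent[OF orth])
  then have fin: "finite B" by (rule independent_imp_finite)
  have rep: "representation B v b = v \<bullet> b" if v: "v \<in> span B" and b: "b \<in> B" for v b
  proof -
    have "v \<bullet> b = (\<Sum>c\<in>B. representation B v c *\<^sub>R c) \<bullet> b"
      using sum_representation_eq[OF ind v fin subset_refl] by simp
    also have "\<dots> = (\<Sum>c\<in>B. if c = b then representation B v c else 0)"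
      unfolding inner_sum_left
    proof (rule sum.cong[OF refl])
      fix c assume "c \<in> B"
      then show "(representation B v c *\<^sub>R c) \<bullet> b = (if c = b then representation B v c else 0)"
        using orth unit[OF b] b by (auto simp: pairwise_def orthogonal_def norm_eq_1)
    qed
    also have "\<dots> = representation B v b" using b fin by simp
    finally show ?thesis by simp
  qed
  have "f b \<in> span B" if "b \<in> B" for b
    using V span_base[OF that] by blast
  then show ?thesis
    by (simp add: endo_trace_eq[OF f V ind refl] rep)
qed

lemma inner_gq_e: "v \<bullet> gq_e i = snd v $ i"
  by (simp add: gq_e_def inner_prod_def inner_axis)

lemma inj_gq_e: "inj gq_e"
  by (auto simp: inj_on_def gq_e_def axis_eq_axis)

lemma endo_trace_gq_lie_algebra:
  assumes "linear f" "f ` gq_lie_algebra l1 l2 l3 \<subseteq> gq_lie_algebra l1 l2 l3"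
  shows "endo_trace (gq_lie_algebra l1 l2 l3) f = (\<Sum>i\<in>UNIV. snd (f (gq_e i)) $ i)"
proof -
  have "pairwise orthogonal (range gq_e)"
    by (auto simp: pairwise_def orthogonal_def inner_gq_e gq_e_sel)
  moreover have "norm b = 1" if "b \<in> range gq_e" for b
    using that by (auto simp: norm_eq_1 inner_gq_e gq_e_sel)
  ultimately show ?thesis
    using assms
    by (simp add: gq_lie_algebra_eq endo_trace_orthonormal sum.reindex[OF inj_gq_e] inner_gq_e)
qed

lemma linear_gq_Ad: "linear (gq_Ad l1 l2 l3 x)"
  using bilinear_gq_bracket[of l1 l2 l3] unfolding gq_Ad_def bilinear_def by blast

lemma gq_Ad_in_gq_lie_algebra: "gq_Ad l1 l2 l3 x y \<in> gq_lie_algebra l1 l2 l3"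
  unfolding gq_Ad_def gq_bracket_def Let_def gq_lie_algebra_eq
  by (intro span_add span_scale span_base rangeI)

text \<open>
  The \<open>i\<close>-th diagonal entry of \<open>Ad\<^sub>X Ad\<^sub>Y\<close> is a combination of the two products \<open>x\<^sub>j y\<^sub>j\<close> with
  \<open>j \<noteq> i\<close>. Each product thus occurs in two of the three entries, both times with the factor \<open>-4\<close>
  and the same pair of parameters, which gives the coefficient \<open>-8\<close>.
\<close>

lemma killing_form_eq:
  "killing_form l1 l2 l3 x y =
    - 8 * (l1 * l2 * snd x $ 1 * snd y $ 1 + l1 * l3 * snd x $ 2 * snd y $ 2
      + l2 * l3 * snd x $ 3 * snd y $ 3)"
proof -
  have "linear (gq_Ad l1 l2 l3 x \<circ> gq_Ad l1 l2 l3 y)"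
    by (intro linear_compose linear_gq_Ad)
  moreover have "(gq_Ad l1 l2 l3 x \<circ> gq_Ad l1 l2 l3 y) ` gq_lie_algebra l1 l2 l3
      \<subseteq> gq_lie_algebra l1 l2 l3"
    by (auto simp: gq_Ad_in_gq_lie_algebra)
  ultimately have "killing_form l1 l2 l3 x y =
      (\<Sum>i\<in>UNIV. snd ((gq_Ad l1 l2 l3 x \<circ> gq_Ad l1 l2 l3 y) (gq_e i)) $ i)"
    unfolding killing_form_def by (rule endo_trace_gq_lie_algebra)
  then show ?thesis
    by (simp add: sum_3 gq_Ad_def gq_bracket_def Let_def gq_e_sel algebra_simps)
qed

theorem theorem5p9:
  fixes l1 l2 l3 :: real
  shows "killing_matrix l1 l2 l3 = (- 8) *\<^sub>R gq_eps l1 l2 l3"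
  by (simp add: vec_eq_iff forall_3 killing_matrix_def gq_eps_def killing_form_eq gq_e_sel)

end
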